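(* Let $f:\mathbb{R}^N\to\mathbb{R}$ be convex and differentiable, let $\hat S$ be a proper sampling with probability vector $p=(p_1,\dots,p_n)$, and let $v\in\mathbb{R}^n_{++}$ be such that $(f,\hat S)\sim ESO(v)$. For any optimal solution $x_*$ of the problem of minimizing $f$ over $\mathbb{R}^N$, the output of the Parallel Coordinate Descent (PCD) algorithm satisfies, for all $k\ge1$, $$\max\Big\{\mathbf{E}\Big[f\Big(\tfrac{x_k+\min_ip_i\sum_{l=1}^{k-1}x_l}{1+(k-1)\min_ip_i}\Big)\Big],\ \min_{l=1,\dots,k}\mathbf{E}[f(x_l)]\Big\}-f(x_* )\ \le\ \frac{(1-\min_ip_i)\big(f(x_0)-f(x_* )\big)+\frac12\|x_0-x_*\|_v^2}{(k-1)\min_ip_i+1}.$$ In particular, for $\epsilon>0$ and $k\ge 1$, if $$k\ge\frac{(1-\min_ip_i)\big(f(x_0)-f(x_* )\big)+\frac12\|x_0-x_*\|_v^2}{\epsilon\,\min_ip_i}-\frac{1}{\min_ip_i}+1,$$ then $$\max\Big\{\mathbf{E}\Big[f\Big(\tfrac{x_k+\min_ip_i\sum_{l=1}^{k-1}x_l}{1+(k-1)\min_ip_i}\Big)\Big],\ \min_{l=1,\dots,k}\mathbf{E}[f(x_l)]\Big\}-f(x_* )\le\epsilon.$$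
   Context: Block structure: $\mathbb{R}^N=\mathbb{R}^{N_1}\times\dots\times\mathbb{R}^{N_n}$, $[n]=\{1,\dots,n\}$; $x^i\in\mathbb{R}^{N_i}$ is the $i$th block of $x\in\mathbb{R}^N$, and $U_i$ is the $N\times N_i$ column submatrix of the identity with $x^i=U_i^\top x$. For $S\subseteq[n]$, $h_{[S]}=\sum_{i\in S}U_ih^i$. $\nabla_i f(x)=U_i^\top\nabla f(x)$. $\langle\cdot,\cdot\rangle$ is the standard inner product. For each $i$, $B_i$ is a fixed (symmetric) positive definite $N_i\times N_i$ matrix and $\|x^i\|_i^2=\langle B_ix^i,x^i\rangle$. For $w\in\mathbb{R}^n_{++}$ (vectors with positive entries): $\langle x,y\rangle_w=\sum_i w_i\langle x^i,y^i\rangle$ and $\|x\|_w^2=\sum_i w_i\|x^i\|_i^2$. For vectors in $\mathbb{R}^n$: $\circ$ is the elementwise product, and $p^{-1}$ is the elementwise inverse. For $u\in\mathbb{R}^n$, $x\in\mathbb{R}^N$: $u\cdot x=\sum_i u_iU_ix^i$. Sampling: a sampling $\hat S$ is a random subset of $[n]$; $p_i=\mathrm{Prob}(i\in\hat S)$; it is proper if $p_i>0$ for all $i$. ESO: $(f,\hat S)\sim ESO(v)$ means that for all $x,h\in\mathbb{R}^N$, $\mathbf{E}[f(x+h_{[\hat S]})]\le f(x)+\langle\nabla f(x),h\rangle_p+\frac12\|h\|^2_{v\circ p}$. PCD algorithm: choose $x_0\in\mathbb{R}^N$, set $z_0=x_0$ and $\theta_0=\min_ip_i$. For $k\ge0$: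 $y_k=(1-\theta_0)x_k+\theta_0z_k$; draw a random set $S_k$ with the distribution of $\hat S$, independently of the past; set $z_{k+1}^i=z_k^i-\frac{p_i}{v_i\theta_0}B_i^{-1}\nabla_if(y_k)$ for $i\in S_k$ and $z_{k+1}^i=z_k^i$ for $i\notin S_k$; set $x_{k+1}=y_k+\theta_0p^{-1}\cdot(z_{k+1}-z_k)$. *)

theory Defs
  imports "HOL-Probability.Probability"
begin

text \<open>
  The coordinates of \<open>\<real>\<^sup>N\<close> are indexed by a finite type \<open>'d\<close>, the blocks by a finite type \<open>'n\<close>,
  and \<open>b :: 'd \<Rightarrow> 'n\<close> assigns each coordinate to its block, so \<open>N\<^sub>i\<close> is the cardinality of
  \<open>b -` {i}\<close>. As \<open>N\<^sub>i\<close> varies with \<open>i\<close>, a block \<open>x\<^sup>i\<close> is represented by its embedding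
  \<open>U\<^sub>i x\<^sup>i = U\<^sub>i U\<^sub>i\<^sup>T x\<close> (zero outside block \<open>i\<close>), and an \<open>N\<^sub>i \<times> N\<^sub>i\<close> matrix \<open>A\<close>
  by \<open>U\<^sub>i A U\<^sub>i\<^sup>T\<close>. Inner products, matrix-vector and matrix-matrix products commute with
  these embeddings.
\<close>

definition block_part :: "('d::finite \<Rightarrow> 'n::finite) \<Rightarrow> 'n \<Rightarrow> real^'d \<Rightarrow> real^'d" where
  "block_part b i x = (\<chi> j. if b j = i then x $ j else 0)"

definition restrict_blocks :: "('d::finite \<Rightarrow> 'n::finite) \<Rightarrow> 'n set \<Rightarrow> real^'d \<Rightarrow> real^'d" where
  "restrict_blocks b S h = (\<Sum>i\<in>S. block_part b i h)"

definition block_scale :: "('d::finite \<Rightarrow> 'n::finite) \<Rightarrow> real^'n \<Rightarrow> real^'d \<Rightarrow> real^'d" where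
  "block_scale b u x = (\<Sum>i\<in>UNIV. (u $ i) *\<^sub>R block_part b i x)"

definition is_block_matrix :: "('d::finite \<Rightarrow> 'n::finite) \<Rightarrow> 'n \<Rightarrow> real^'d^'d \<Rightarrow> bool" where
  "is_block_matrix b i A \<longleftrightarrow> (\<forall>j k. b j \<noteq> i \<or> b k \<noteq> i \<longrightarrow> A $ j $ k = 0)"

definition block_id :: "('d::finite \<Rightarrow> 'n::finite) \<Rightarrow> 'n \<Rightarrow> real^'d^'d" where
  "block_id b i = (\<chi> j k. if j = k \<and> b j = i then 1 else 0)"

definition block_pos_def :: "('d::finite \<Rightarrow> 'n::finite) \<Rightarrow> 'n \<Rightarrow> real^'d^'d \<Rightarrow> bool" where
  "block_pos_def b i A \<longleftrightarrow> is_block_matrix b i A \<and> transpose A = A \<and>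
     (\<forall>h. block_part b i h \<noteq> 0 \<longrightarrow> (A *v block_part b i h) \<bullet> block_part b i h > 0)"

text \<open>The embedding of the inverse of an \<open>N\<^sub>i \<times> N\<^sub>i\<close> matrix; cf. \<^const>\<open>matrix_inv\<close>.\<close>

definition block_inv :: "('d::finite \<Rightarrow> 'n::finite) \<Rightarrow> 'n \<Rightarrow> real^'d^'d \<Rightarrow> real^'d^'d" where
  "block_inv b i A =
     (THE C. is_block_matrix b i C \<and> A ** C = block_id b i \<and> C ** A = block_id b i)"

definition winner :: "('d::finite \<Rightarrow> 'n::finite) \<Rightarrow> real^'n \<Rightarrow> real^'d \<Rightarrow> real^'d \<Rightarrow> real" where
  "winner b w x y = (\<Sum>i\<in>UNIV. w $ i * (block_part b i x \<bullet> block_part b i y))"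

definition wnorm_sq ::
  "('d::finite \<Rightarrow> 'n::finite) \<Rightarrow> ('n \<Rightarrow> real^'d^'d) \<Rightarrow> real^'n \<Rightarrow> real^'d \<Rightarrow> real" where
  "wnorm_sq b B w x = (\<Sum>i\<in>UNIV. w $ i * ((B i *v block_part b i x) \<bullet> block_part b i x))"

definition gradient :: "('a::real_inner \<Rightarrow> real) \<Rightarrow> 'a \<Rightarrow> 'a" where
  "gradient f x = (THE D. GDERIV f x :> D)"

text \<open>A sampling is the distribution of a random subset of the (finite) set of blocks.\<close>

definition sampling_prob :: "('n::finite) set pmf \<Rightarrow> real^'n" where
  "sampling_prob \<S> = (\<chi> i. measure_pmf.prob \<S> {T. i \<in> T})"

definition proper_sampling :: "('n::finite) set pmf \<Rightarrow> bool" where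
  "proper_sampling \<S> \<longleftrightarrow> (\<forall>i. sampling_prob \<S> $ i > 0)"

text \<open>The product of two vectors of type \<open>real^'n\<close> is the elementwise one.\<close>

definition ESO :: "('d::finite \<Rightarrow> 'n::finite) \<Rightarrow> ('n \<Rightarrow> real^'d^'d) \<Rightarrow> (real^'d \<Rightarrow> real) \<Rightarrow>
    'n set pmf \<Rightarrow> real^'n \<Rightarrow> bool" where
  "ESO b B f \<S> v \<longleftrightarrow> (\<forall>x h.
     measure_pmf.expectation \<S> (\<lambda>T. f (x + restrict_blocks b T h))
       \<le> f x + winner b (sampling_prob \<S>) (gradient f x) h
           + 1/2 * wnorm_sq b B (v * sampling_prob \<S>) h)"

definition min_entry :: "real^'n::finite \<Rightarrow> real" where
  "min_entry p = Min (range (\<lambda>i. p $ i))"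

text \<open>One step of the algorithm, mapping \<open>(x\<^sub>k, z\<^sub>k)\<close> to \<open>(x\<^sub>k\<^sub>+\<^sub>1, z\<^sub>k\<^sub>+\<^sub>1)\<close> when the set drawn is \<open>T\<close>.\<close>

definition pcd_step :: "('d::finite \<Rightarrow> 'n::finite) \<Rightarrow> ('n \<Rightarrow> real^'d^'d) \<Rightarrow> (real^'d \<Rightarrow> real) \<Rightarrow>
    real^'n \<Rightarrow> real^'n \<Rightarrow> 'n set \<Rightarrow> (real^'d) \<times> (real^'d) \<Rightarrow> (real^'d) \<times> (real^'d)" where
  "pcd_step b B f p v T = (\<lambda>(x, z).
     let \<theta> = min_entry p;
         y = (1 - \<theta>) *\<^sub>R x + \<theta> *\<^sub>R z;
         z' = (\<Sum>i\<in>UNIV.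
                 if i \<in> T
                 then block_part b i z - (p $ i / (v $ i * \<theta>)) *\<^sub>R
                        (block_inv b i (B i) *v block_part b i (gradient f y))
                 else block_part b i z);
         x' = y + \<theta> *\<^sub>R block_scale b (\<chi> i. inverse (p $ i)) (z' - z)
     in (x', z'))"

primrec pcd :: "('d::finite \<Rightarrow> 'n::finite) \<Rightarrow> ('n \<Rightarrow> real^'d^'d) \<Rightarrow> (real^'d \<Rightarrow> real) \<Rightarrow>
    real^'n \<Rightarrow> real^'n \<Rightarrow> real^'d \<Rightarrow> (nat \<Rightarrow> 'n set) \<Rightarrow> nat \<Rightarrow> (real^'d) \<times> (real^'d)" where
  "pcd b B f p v x0 S 0 = (x0, x0)"
| "pcd b B f p v x0 S (Suc k) = pcd_step b B f p v (S k) (pcd b B f p v x0 S k)"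

text \<open>The definite descriptions in \<^const>\<open>gradient\<close> and \<^const>\<open>block_inv\<close> are well-defined.\<close>

lemma gradient_eq:
  fixes f :: "'a::euclidean_space \<Rightarrow> real"
  assumes "f differentiable (at x)"
  shows "GDERIV f x :> gradient f x"
proof -
  obtain f' where f': "(f has_derivative f') (at x)"
    using assms by (auto simp: differentiable_def)
  then interpret bounded_linear f' by (rule has_derivative_bounded_linear)
  have ex: "GDERIV f x :> adjoint f' (1::real)"
    using f' adjoint_works[OF linear_axioms, of _ 1] 
    by (simp add: gderiv_def)
  moreover have "D = adjoint f' (1::real)" if "GDERIV f x :> D" for D
  proof -
    have "(\<lambda>h. h \<bullet> D) = (\<lambda>h. h \<bullet> adjoint f' (1::real))"
      using that ex unfolding gderiv_def by (rule has_derivative_unique)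
    then show ?thesis
      by (simp add: fun_eq_iff vector_eq_ldot)
  qed
  ultimately show ?thesis
    unfolding gradient_def by (rule theI)
qed

lemma block_id_mult:
  assumes "is_block_matrix b i C"
  shows "block_id b i ** C = C"
proof -
  have "(block_id b i ** C) $ j $ k = C $ j $ k" for j k
  proof -
    have "(block_id b i ** C) $ j $ k = (\<Sum>l\<in>UNIV. if l = j then C $ j $ k else 0)"
      unfolding matrix_matrix_mult_def block_id_def vec_lambda_beta
      using assms by (intro sum.cong) (auto simp: is_block_matrix_def)
    then show ?thesis by simp
  qed
  then show ?thesis by (simp add: vec_eq_iff)
qed

lemma mult_block_id:
  assumes "is_block_matrix b i C"
  shows "C ** block_id b i = C"
proof -
  have "(C ** block_id b i) $ j $ k = C $ j $ k" for j k
  proof -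
    have "(C ** block_id b i) $ j $ k = (\<Sum>l\<in>UNIV. if l = k then C $ j $ k else 0)"
      unfolding matrix_matrix_mult_def block_id_def vec_lambda_beta
      using assms by (intro sum.cong) (auto simp: is_block_matrix_def)
    then show ?thesis by simp
  qed
  then show ?thesis by (simp add: vec_eq_iff)
qed

lemma block_id_vec: "block_id b i *v x = block_part b i x"
proof -
  have "(block_id b i *v x) $ j = block_part b i x $ j" for j
  proof -
    have "(block_id b i *v x) $ j = (\<Sum>l\<in>UNIV. if l = j then block_part b i x $ j else 0)"
      unfolding matrix_vector_mult_def block_id_def block_part_def vec_lambda_beta
      by (intro sum.cong) auto
    then show ?thesis by simp
  qed
  then show ?thesis by (simp add: vec_eq_iff)
qed

lemma block_inv_spec:
  assumes "block_pos_def b i A"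
  shows "is_block_matrix b i (block_inv b i A)"
    and "A ** block_inv b i A = block_id b i"
    and "block_inv b i A ** A = block_id b i"
proof -
  let ?E = "block_id b i"
  let ?P = "\<lambda>C. is_block_matrix b i C \<and> A ** C = ?E \<and> C ** A = ?E"
  have A: "is_block_matrix b i A" using assms by (simp add: block_pos_def_def)
  have E: "is_block_matrix b i ?E" by (auto simp: block_id_def is_block_matrix_def)
  have EE: "?E ** ?E = ?E" by (rule block_id_mult[OF E])
  have AE: "A ** ?E = A" "?E ** A = A" using A by (simp_all add: mult_block_id block_id_mult)
  note Ev = block_id_vec[of b i]
  define M where "M = A + (mat 1 - ?E)"
  have Mv: "M *v x = A *v x + (x - ?E *v x)" for x
    by (simp add: M_def matrix_vector_mult_add_rdistrib matrix_vector_mult_diff_rdistrib)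
  have AEv: "A *v (?E *v x) = A *v x" "?E *v (A *v x) = A *v x" "?E *v (?E *v x) = ?E *v x" for x
    by (simp_all add: matrix_vector_mul_assoc AE EE)
  have EM: "?E ** M = A" "M ** ?E = A"
    by (simp_all add: matrix_eq matrix_vector_mul_assoc[symmetric] Mv AEv
        matrix_vector_right_distrib matrix_vector_mult_diff_distrib)
  have "x = 0" if x: "M *v x = 0" for x
  proof -
    have Ax: "A *v x = 0"
      using matrix_vector_mul_assoc[of ?E M x] EM(1) x by simp
    then have "A *v block_part b i x = 0"
      using AEv(1)[of x] by (simp add: Ev)
    then have 0: "block_part b i x = 0"
      using assms by (fastforce simp: block_pos_def_def)
    show ?thesis using x Ax 0 Ev Mv[of x] by simp
  qed
  then have "invertible M"
    using matrix_left_invertible_ker invertible_left_inverse by blast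
  then obtain W where W: "M ** W = mat 1" "W ** M = mat 1"
    by (auto simp: invertible_def)
  have WA: "W ** A = ?E" "A ** W = ?E"
    using matrix_mul_assoc[of W M ?E] matrix_mul_assoc[of ?E M W] EM W by simp_all
  define C where "C = ?E ** W ** ?E"
  have "C ** ?E = C"
    unfolding C_def matrix_mul_assoc[symmetric] EE ..
  moreover have "?E ** C = C"
    unfolding C_def matrix_mul_assoc EE ..
  ultimately have CE: "C ** ?E = C" "?E ** C = C" .
  have Cb: "is_block_matrix b i C"
    unfolding is_block_matrix_def
  proof (intro allI impI)
    fix j k assume "b j \<noteq> i \<or> b k \<noteq> i"
    moreover have "(C ** ?E) $ j $ k = 0" if "b k \<noteq> i"
      using that unfolding matrix_matrix_mult_def block_id_def vec_lambda_beta
      by (intro sum.neutral) auto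
    moreover have "(?E ** C) $ j $ k = 0" if "b j \<noteq> i"
      using that unfolding matrix_matrix_mult_def block_id_def vec_lambda_beta
      by (intro sum.neutral) auto
    ultimately show "C $ j $ k = 0" by (auto simp: CE)
  qed
  have "A ** C = ?E"
    by (simp add: C_def matrix_mul_assoc AE WA EE)
  moreover have "C ** A = ?E"
    by (simp add: C_def matrix_mul_assoc[symmetric] AE WA EE)
  ultimately have C: "?P C" using Cb by simp
  have "D = C" if D: "?P D" for D
    using matrix_mul_assoc[of D A C] mult_block_id[of b i D] block_id_mult[of b i C] D C by simp
  then have "?P (block_inv b i A)"
    unfolding block_inv_def using C by (rule theI[of ?P C, rotated])
  then show "is_block_matrix b i (block_inv b i A)"
    and "A ** block_inv b i A = block_id b i"
    and "block_inv b i A ** A = block_id b i" by blast+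
qed

end

theory Submission
  imports Defs
begin

text \<open>
  The algorithm is analysed through a potential that drops in expectation. Let
  \<open>h = - v\<^sup>-\<^sup>1 \<cdot> B\<^sup>-\<^sup>1 \<nabla>f(y)\<close> at the point \<open>y = (1 - \<theta>) x + \<theta> z\<close>. A step that draws the set \<open>T\<close>
  moves \<open>x\<close> to \<open>y + h\<^sub>[\<^sub>T\<^sub>]\<close> and \<open>z\<close> to \<open>z + \<theta>\<^sup>-\<^sup>1 p \<cdot> h\<^sub>[\<^sub>T\<^sub>]\<close> (\<open>pcd_step_eq\<close>). Here \<open>h\<close> minimises the
  upper bound that the ESO inequality gives for the mean of \<open>f\<close> after the step, so that this mean is
  at most \<open>f(y) - \<rho>/2\<close>, where \<open>\<rho>\<close> is the sum of \<open>p\<^sub>i / v\<^sub>i\<close> times the squared dual norm of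
  \<open>\<nabla>\<^sub>i f(y)\<close>. Measure the distance of \<open>z\<close> to a reference point \<open>u\<close> with the weights
  \<open>w = v / p\<^sup>2\<close> rather than \<open>v\<close>: one factor \<open>1/p\<^sub>i\<close> cancels the probability that block \<open>i\<close> is drawn,
  the other one the step length \<open>p\<^sub>i\<close>. Then \<open>\<theta>\<^sup>2/2 \<cdot> \<parallel>z - u\<parallel>\<^sub>w\<^sup>2\<close> changes in the mean by exactly
  \<open>\<rho>/2 - \<theta> \<langle>\<nabla>f(y), z - u\<rangle>\<close>. Adding both, \<open>\<rho>\<close> cancels, and since
  \<open>\<theta> (z - u) = (1 - \<theta>) (y - x) + \<theta> (y - u)\<close>, convexity bounds what remains by
  \<open>(1 - \<theta>) f(x) + \<theta> f(u)\<close>. This is \<open>pcd_step_descent\<close>.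

  For \<open>u = x\<^sub>*\<close>, and with the expectation over all draws (\<open>expectation_fresh_draw\<close>), the recursion
  \<open>F\<^sub>k\<^sub>+\<^sub>1 + R\<^sub>k\<^sub>+\<^sub>1 \<le> (1 - \<theta>) F\<^sub>k + R\<^sub>k\<close> results for the mean optimality gaps \<open>F\<^sub>k\<close> and the mean
  distance terms \<open>R\<^sub>k \<ge> 0\<close>. Summing it bounds \<open>F\<^sub>k + \<theta> (F\<^sub>1 + \<dots> + F\<^sub>k\<^sub>-\<^sub>1)\<close> by
  \<open>(1 - \<theta>) F\<^sub>0 + R\<^sub>0\<close> (\<open>weighted_average_telescope\<close>), and \<open>R\<^sub>0 \<le> \<parallel>x\<^sub>0 - x\<^sub>*\<parallel>\<^sub>v\<^sup>2 / 2\<close> because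
  \<open>\<theta> \<le> p\<^sub>i\<close>. The weights \<open>1, \<theta>, \<dots>, \<theta>\<close> add up to \<open>1 + (k - 1) \<theta>\<close>; the weighted average of the
  gaps dominates both the smallest gap and, by Jensen's inequality, the gap at the averaged point.
\<close>

section \<open>Convex functions and weighted averages\<close>

text \<open>Along the segment from \<open>y\<close> to \<open>x\<close> this is the tangent inequality for a convex function of one
  real variable.\<close>

lemma convex_on_above_gradient:
  fixes f :: "'a::euclidean_space \<Rightarrow> real"
  assumes "convex_on UNIV f" and "f differentiable (at y)"
  shows "f y + gradient f y \<bullet> (x - y) \<le> f x"
proof -
  define \<phi> where "\<phi> t = f (y + t *\<^sub>R (x - y))" for t :: real
  have "convex_on UNIV \<phi>"
  proof (rule convex_onI)
    fix t a c :: real assume t: "0 < t" "t < 1"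
    have "y + ((1 - t) *\<^sub>R a + t *\<^sub>R c) *\<^sub>R (x - y)
        = (1 - t) *\<^sub>R (y + a *\<^sub>R (x - y)) + t *\<^sub>R (y + c *\<^sub>R (x - y))"
      by (simp add: algebra_simps)
    then show "\<phi> ((1 - t) *\<^sub>R a + t *\<^sub>R c) \<le> (1 - t) * \<phi> a + t * \<phi> c"
      using convex_onD[OF assms(1), of t "y + a *\<^sub>R (x - y)" "y + c *\<^sub>R (x - y)"] t
      by (simp add: \<phi>_def)
  qed simp
  moreover have "(\<phi> has_real_derivative gradient f y \<bullet> (x - y)) (at 0)"
  proof -
    have "(f has_derivative (\<lambda>h. h \<bullet> gradient f y)) (at (y + 0 *\<^sub>R (x - y)))"
      using gradient_eq[OF assms(2)] by (simp add: gderiv_def)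
    then have "((\<lambda>t. f (y + t *\<^sub>R (x - y))) has_derivative
        (\<lambda>t. (t *\<^sub>R (x - y)) \<bullet> gradient f y)) (at 0)"
      by (rule has_derivative_compose[rotated]) (auto intro!: derivative_eq_intros)
    then show ?thesis
      unfolding \<phi>_def has_field_derivative_def
      by (rule has_derivative_eq_rhs) (auto simp: inner_commute mult.commute)
  qed
  ultimately have "(gradient f y \<bullet> (x - y)) * (1 - 0) \<le> \<phi> 1 - \<phi> 0"
    by (intro convex_on_imp_above_tangent[where A = UNIV]) (auto)
  then show ?thesis by (simp add: \<phi>_def)
qed

lemma weighted_sum_split:
  fixes g :: "nat \<Rightarrow> 'a::real_vector"
  assumes "k \<ge> 1"
  shows "(\<Sum>l = 1..k. (if l = k then 1 else \<theta>) *\<^sub>R g l) = g k + \<theta> *\<^sub>R (\<Sum>l = 1..k - 1. g l)"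
proof -
  have "{1..k} = insert k {1..k - 1}" using assms by auto
  moreover have "(\<Sum>l = 1..k - 1. (if l = k then 1 else \<theta>) *\<^sub>R g l) = \<theta> *\<^sub>R (\<Sum>l = 1..k - 1. g l)"
    using assms unfolding scaleR_sum_right by (intro sum.cong) auto
  ultimately show ?thesis using assms by simp
qed

lemma convex_on_weighted_average:
  fixes y :: "nat \<Rightarrow> 'a::real_vector"
  assumes f: "convex_on UNIV f" and \<theta>: "\<theta> \<ge> 0" and k: "k \<ge> 1"
  shows "f ((1 / (1 + (real k - 1) * \<theta>)) *\<^sub>R (y k + \<theta> *\<^sub>R (\<Sum>l = 1..k - 1. y l)))
       \<le> (f (y k) + \<theta> * (\<Sum>l = 1..k - 1. f (y l))) / (1 + (real k - 1) * \<theta>)"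
proof -
  define W where "W = 1 + (real k - 1) * \<theta>"
  have W: "W > 0" using \<theta> k by (simp add: W_def add_pos_nonneg)
  define a where "a l = (if l = k then 1 else \<theta>)" for l
  have sum_a: "sum a {1..k} = W"
    using weighted_sum_split[OF k, of \<theta> "\<lambda>_. 1::real"] k by (simp add: a_def W_def mult.commute of_nat_diff)
  have "f (\<Sum>l = 1..k. (a l / W) *\<^sub>R y l) \<le> (\<Sum>l = 1..k. a l / W * f (y l))"
    using W k \<theta> sum_a
    by (intro convex_on_sum[OF _ _ f]) (auto simp: a_def sum_divide_distrib[symmetric])
  moreover have "(\<Sum>l = 1..k. (a l / W) *\<^sub>R y l) = (1 / W) *\<^sub>R (y k + \<theta> *\<^sub>R (\<Sum>l = 1..k - 1. y l))"
    unfolding weighted_sum_split[OF k, symmetric] by (simp add: scaleR_sum_right a_def)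
  moreover have "(\<Sum>l = 1..k. a l / W * f (y l)) = (f (y k) + \<theta> * (\<Sum>l = 1..k - 1. f (y l))) / W"
    using weighted_sum_split[OF k, of \<theta> "\<lambda>l. f (y l)"] by (simp add: sum_divide_distrib[symmetric] a_def)
  ultimately show ?thesis by (simp add: W_def)
qed

lemma Min_le_weighted_average:
  fixes e :: "nat \<Rightarrow> real"
  assumes \<theta>: "\<theta> \<ge> 0" and k: "k \<ge> 1"
  shows "Min (e ` {1..k}) \<le> (e k + \<theta> * (\<Sum>l = 1..k - 1. e l)) / (1 + (real k - 1) * \<theta>)"
proof -
  define m where "m = Min (e ` {1..k})"
  have m: "m \<le> e l" if "l \<in> {1..k}" for l using that by (simp add: m_def)
  have "(\<Sum>l = 1..k - 1. m) \<le> (\<Sum>l = 1..k - 1. e l)"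
    by (intro sum_mono m) auto
  then have "\<theta> * ((real k - 1) * m) \<le> \<theta> * (\<Sum>l = 1..k - 1. e l)"
    using \<theta> k by (intro mult_left_mono) (auto simp: of_nat_diff)
  then have "m * (1 + (real k - 1) * \<theta>) \<le> e k + \<theta> * (\<Sum>l = 1..k - 1. e l)"
    using m[of k] k by (simp add: algebra_simps)
  then show ?thesis
    unfolding m_def[symmetric] using \<theta> k by (subst pos_le_divide_eq) (auto simp: add_pos_nonneg)
qed

text \<open>Each step from \<open>l\<close> to \<open>l + 1\<close> leaves a residue \<open>\<theta> F\<^sub>l\<close>. Only the steps with \<open>l \<ge> 1\<close> contribute
  one, as the first step keeps its factor \<open>1 - \<theta>\<close> on the right-hand side.\<close>

lemma weighted_average_telescope:
  fixes F R :: "nat \<Rightarrow> real"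
  assumes "\<And>k. F (Suc k) + R (Suc k) \<le> (1 - \<theta>) * F k + R k" and "k \<ge> 1"
  shows "F k + \<theta> * (\<Sum>l = 1..k - 1. F l) + R k \<le> (1 - \<theta>) * F 0 + R 0"
  using assms(2)
proof (induction k rule: dec_induct)
  case base
  show ?case using assms(1)[of 0] by simp
next
  case (step n)
  have "(\<Sum>l = 1..Suc n - 1. F l) = (\<Sum>l = 1..n - 1. F l) + F n"
    using step(1) by (cases n) auto
  then show ?case using step assms(1)[of n] by (simp add: algebra_simps)
qed


section \<open>Block structure\<close>

lemma linear_block_part: "linear (block_part b i)"
  by (rule linearI) (auto simp: block_part_def vec_eq_iff)

lemmas block_part_simps =
  linear_add[OF linear_block_part] linear_diff[OF linear_block_part]
  linear_scale[OF linear_block_part] linear_sum[OF linear_block_part]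

lemma block_part_block_part:
  "block_part b i (block_part b j x) = (if i = j then block_part b i x else 0)"
  by (auto simp: block_part_def vec_eq_iff)

lemma block_part_restrict_blocks:
  "block_part b i (restrict_blocks b T x) = (if i \<in> T then block_part b i x else 0)"
  by (simp add: restrict_blocks_def block_part_simps block_part_block_part)

lemma block_part_block_scale:
  "block_part b i (block_scale b u x) = u $ i *\<^sub>R block_part b i x"
  by (simp add: block_scale_def block_part_simps block_part_block_part if_distrib cong: if_cong)

lemma vec_eq_blocksI:
  assumes "\<And>i. block_part b i x = block_part b i y"
  shows "x = y"
proof -
  have "x $ j = y $ j" for j
    using arg_cong[OF assms[of "b j"], of "\<lambda>u. u $ j"] by (simp add: block_part_def)
  then show ?thesis by (simp add: vec_eq_iff)
qed

lemma inner_eq_winner: "x \<bullet> y = winner b 1 x y"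
proof -
  have "winner b 1 x y = (\<Sum>i\<in>UNIV. \<Sum>j\<in>UNIV. if b j = i then x $ j * y $ j else 0)"
    unfolding winner_def inner_vec_def block_part_def by (intro sum.cong) (auto intro!: sum.cong)
  also have "\<dots> = (\<Sum>j\<in>UNIV. \<Sum>i\<in>UNIV. if b j = i then x $ j * y $ j else 0)"
    by (rule sum.swap)
  finally show ?thesis by (simp add: inner_vec_def)
qed

section \<open>Independence of the next draw from the past\<close>

text \<open>A function of the first \<open>k\<close> draws factors through the restriction to \<open>{..<k}\<close>, which takes
  values in a finite discrete space. This settles all measurability and integrability questions about
  the iterates. The first two parts put such a function into the form to which independence of disjoint
  groups of variables applies.\<close>

lemma (in prob_space) measurable_history:
  fixes S :: "nat \<Rightarrow> 'a \<Rightarrow> 's::finite" and h :: "(nat \<Rightarrow> 's) \<Rightarrow> real"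
  assumes rv: "\<And>l. random_variable (count_space UNIV) (S l)"
    and dep: "\<And>s t. (\<And>l. l < k \<Longrightarrow> s l = t l) \<Longrightarrow> h s = h t"
  shows "h \<in> borel_measurable (PiM {..<k} (\<lambda>_. count_space UNIV))"
    and "h (\<lambda>l. S l \<omega>) = h (restrict (\<lambda>l. S l \<omega>) {..<k})"
    and "integrable M (\<lambda>\<omega>. h (\<lambda>l. S l \<omega>))"
proof -
  show meas: "h \<in> borel_measurable (PiM {..<k} (\<lambda>_. count_space UNIV))"
    by (subst count_space_PiM_finite) auto
  show eq: "h (\<lambda>l. S l \<omega>) = h (restrict (\<lambda>l. S l \<omega>) {..<k})" for \<omega>
    by (rule dep) simp
  have fin: "finite (h ` (\<Pi>\<^sub>E l\<in>{..<k}. UNIV))"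
    by (intro finite_imageI finite_PiE) auto
  show "integrable M (\<lambda>\<omega>. h (\<lambda>l. S l \<omega>))"
  proof (rule integrable_const_bound)
    show "AE \<omega> in M. norm (h (\<lambda>l. S l \<omega>)) \<le> Max (norm ` h ` (\<Pi>\<^sub>E l\<in>{..<k}. UNIV))"
      unfolding eq using fin by (intro AE_I2 Max_ge) auto
    show "(\<lambda>\<omega>. h (\<lambda>l. S l \<omega>)) \<in> borel_measurable M"
      unfolding eq
      by (rule measurable_compose[OF _ meas]) (intro measurable_restrict rv)
  qed
qed

text \<open>Averaging over the \<open>k\<close>-th draw first: this is conditioning on the past. For each of the finitely
  many values \<open>T\<close> of the draw, \<open>\<phi> \<cdot> T\<close> depends on the earlier draws only, so it is independent of
  the event that \<open>T\<close> is drawn.\<close>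

lemma (in prob_space) expectation_fresh_draw:
  fixes S :: "nat \<Rightarrow> 'a \<Rightarrow> 's::finite" and \<phi> :: "(nat \<Rightarrow> 's) \<Rightarrow> 's \<Rightarrow> real"
  assumes indep: "indep_vars (\<lambda>_. count_space UNIV) S UNIV"
    and distr: "distr M (count_space UNIV) (S k) = measure_pmf Q"
    and dep: "\<And>s t T. (\<And>l. l < k \<Longrightarrow> s l = t l) \<Longrightarrow> \<phi> s T = \<phi> t T"
  shows "expectation (\<lambda>\<omega>. \<phi> (\<lambda>l. S l \<omega>) (S k \<omega>))
       = expectation (\<lambda>\<omega>. measure_pmf.expectation Q (\<phi> (\<lambda>l. S l \<omega>)))"
proof -
  have rv: "random_variable (count_space UNIV) (S l)" for l
    using indep by (simp add: indep_vars_def)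
  note hist = measurable_history[where S = S and k = k and h = "\<lambda>s. \<phi> s T" for T, OF rv dep]
  have ind1: "integrable M (\<lambda>\<omega>. indicator {T} (S k \<omega>) :: real)" for T
    using rv[of k] by (intro integrable_const_bound[where B = 1] measurable_compose[OF rv]) auto
  have ind2: "expectation (\<lambda>\<omega>. indicator {T} (S k \<omega>) :: real) = pmf Q T" for T
  proof -
    have "expectation (\<lambda>\<omega>. indicator {T} (S k \<omega>) :: real)
        = integral\<^sup>L (distr M (count_space UNIV) (S k)) (indicator {T})"
      by (subst integral_distr[OF rv]) auto
    then show ?thesis
      unfolding distr by (simp add: measure_pmf_single)
  qed
  have iv: "indep_var borel (\<lambda>\<omega>. \<phi> (\<lambda>l. S l \<omega>) T) borel (\<lambda>\<omega>. indicator {T} (S k \<omega>))" for T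
  proof -
    have "indep_var borel ((\<lambda>s. \<phi> s T) \<circ> (\<lambda>\<omega>. restrict (\<lambda>l. S l \<omega>) {..<k}))
        borel ((\<lambda>s. indicator {T} (s k) :: real) \<circ> (\<lambda>\<omega>. restrict (\<lambda>l. S l \<omega>) {k}))"
      by (rule indep_var_compose[OF indep_var_restrict[OF indep] hist(1)])
        (auto intro!: measurable_compose[OF measurable_component_singleton])
    then show ?thesis
      by (simp add: o_def hist(2)[symmetric])
  qed
  have "expectation (\<lambda>\<omega>. \<phi> (\<lambda>l. S l \<omega>) (S k \<omega>))
      = expectation (\<lambda>\<omega>. \<Sum>T\<in>UNIV. \<phi> (\<lambda>l. S l \<omega>) T * indicator {T} (S k \<omega>))"
    by (simp add: indicator_def of_bool_def if_distrib cong: if_cong)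
  also have "\<dots> = (\<Sum>T\<in>UNIV. expectation (\<lambda>\<omega>. \<phi> (\<lambda>l. S l \<omega>) T * indicator {T} (S k \<omega>)))"
    by (intro Bochner_Integration.integral_sum indep_var_integrable iv hist(3) ind1)
  also have "\<dots> = (\<Sum>T\<in>UNIV. expectation (\<lambda>\<omega>. \<phi> (\<lambda>l. S l \<omega>) T) * pmf Q T)"
    by (simp add: indep_var_lebesgue_integral[OF iv hist(3) ind1] ind2)
  also have "\<dots> = expectation (\<lambda>\<omega>. \<Sum>T\<in>UNIV. \<phi> (\<lambda>l. S l \<omega>) T * pmf Q T)"
    by (subst Bochner_Integration.integral_sum) (auto intro: hist(3))
  also have "\<dots> = expectation (\<lambda>\<omega>. measure_pmf.expectation Q (\<phi> (\<lambda>l. S l \<omega>)))"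
    by (subst integral_measure_pmf_real[of UNIV]) auto
  finally show ?thesis .
qed


section \<open>One step of the algorithm\<close>

lemma min_entry_le: "min_entry p \<le> p $ i"
  by (simp add: min_entry_def)

lemma min_entry_pos: "(\<And>i. 0 < p $ i) \<Longrightarrow> 0 < min_entry p"
  by (simp add: min_entry_def Min_gr_iff)

text \<open>For positive \<open>v\<close> and \<open>p\<close> this is the minimiser over \<open>h\<close> of the right-hand side of the ESO
  inequality with gradient \<open>g\<close>; it is the same for all \<open>p\<close>.\<close>

definition pcd_direction :: "('d::finite \<Rightarrow> 'n::finite) \<Rightarrow> ('n \<Rightarrow> real^'d^'d) \<Rightarrow> real^'n \<Rightarrow>
    real^'d \<Rightarrow> real^'d" where
  "pcd_direction b B v g = (\<Sum>i\<in>UNIV. (- 1 / v $ i) *\<^sub>R (block_inv b i (B i) *v block_part b i g))"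

lemma block_part_block_matrix_vec:
  assumes "is_block_matrix b i A"
  shows "block_part b j (A *v x) = (if j = i then A *v x else 0)"
proof -
  have "A *v x = block_part b i (A *v x)"
    using block_id_mult[OF assms] by (metis block_id_vec matrix_vector_mul_assoc)
  then show ?thesis
    by (metis block_part_block_part)
qed

lemma block_part_pcd_direction:
  assumes "\<And>i. block_pos_def b i (B i)"
  shows "block_part b i (pcd_direction b B v g)
       = (- 1 / v $ i) *\<^sub>R (block_inv b i (B i) *v block_part b i g)"
proof -
  have "block_part b i ((- 1 / v $ j) *\<^sub>R (block_inv b j (B j) *v block_part b j g))
      = (if j = i then (- 1 / v $ i) *\<^sub>R (block_inv b i (B i) *v block_part b i g) else 0)" for j
    by (simp only: linear_scale[OF linear_block_part]
        block_part_block_matrix_vec[OF block_inv_spec(1)[OF assms]]) auto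
  then show ?thesis
    by (simp only: pcd_direction_def linear_sum[OF linear_block_part]) simp
qed

text \<open>So \<open>\<langle>B\<^sub>i h\<^sup>i, h\<^sup>i\<rangle>\<close> and \<open>\<langle>\<nabla>\<^sub>i f(y), h\<^sup>i\<rangle>\<close> agree up to the factor \<open>- 1 / v\<^sub>i\<close>, and the
  inverse of \<open>B\<^sub>i\<close> disappears from the analysis.\<close>

lemma metric_pcd_direction:
  assumes "\<And>i. block_pos_def b i (B i)"
  shows "B i *v block_part b i (pcd_direction b B v g) = (- 1 / v $ i) *\<^sub>R block_part b i g"
proof -
  have "B i *v (block_inv b i (B i) *v block_part b i g) = block_part b i g"
    using block_inv_spec(2)[OF assms[of i]]
    by (simp add: matrix_vector_mul_assoc block_id_vec block_part_block_part)
  then show ?thesis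
    by (simp only: block_part_pcd_direction[OF assms] matrix_vector_mult_scaleR)
qed

text \<open>The factor \<open>\<theta> p\<^sup>-\<^sup>1\<close> in the update of \<open>x\<close> undoes the factor \<open>\<theta>\<^sup>-\<^sup>1 p\<close> in the update of \<open>z\<close>,
  so that \<open>x\<close> makes a plain coordinate descent step from \<open>y\<close>, to which the ESO inequality
  applies.\<close>

lemma pcd_step_eq:
  fixes p v :: "real^'n::finite"
  assumes B: "\<And>i. block_pos_def b i (B i)" and p: "\<And>i. 0 < p $ i"
    and y: "y = (1 - min_entry p) *\<^sub>R x + min_entry p *\<^sub>R z"
    and h: "h = pcd_direction b B v (gradient f y)"
  shows "pcd_step b B f p v T (x, z)
       = (y + restrict_blocks b T h, z + (1 / min_entry p) *\<^sub>R block_scale b p (restrict_blocks b T h))"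
proof -
  define \<theta> where "\<theta> = min_entry p"
  have \<theta>: "\<theta> > 0" using min_entry_pos[of p] p by (simp add: \<theta>_def)
  define z' where "z' = (\<Sum>i\<in>UNIV. if i \<in> T then block_part b i z - (p $ i / (v $ i * \<theta>)) *\<^sub>R
      (block_inv b i (B i) *v block_part b i (gradient f y)) else block_part b i z)"
  have "z' = (\<Sum>i\<in>UNIV. block_part b i (z + (1 / \<theta>) *\<^sub>R block_scale b p (restrict_blocks b T h)))"
    unfolding z'_def h
    by (intro sum.cong) (auto simp: block_part_simps block_part_block_scale block_part_restrict_blocks
        block_part_pcd_direction[OF B])
  also have "\<dots> = z + (1 / \<theta>) *\<^sub>R block_scale b p (restrict_blocks b T h)"
    by (rule vec_eq_blocksI[where b = b])
      (simp add: linear_sum[OF linear_block_part] block_part_block_part if_distrib cong: if_cong)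
  finally have z': "z' = z + (1 / \<theta>) *\<^sub>R block_scale b p (restrict_blocks b T h)" .
  moreover have "\<theta> *\<^sub>R block_scale b (\<chi> i. inverse (p $ i)) (z' - z) = restrict_blocks b T h"
  proof (rule vec_eq_blocksI[where b = b])
    fix i
    show "block_part b i (\<theta> *\<^sub>R block_scale b (\<chi> i. inverse (p $ i)) (z' - z))
        = block_part b i (restrict_blocks b T h)"
      unfolding z' using \<theta> p[of i] by (simp add: block_part_simps block_part_block_scale)
  qed
  ultimately show ?thesis
    unfolding pcd_step_def Let_def prod.case y[symmetric]
    unfolding \<theta>_def[symmetric] unfolding z'_def[symmetric] by simp
qed

lemma expectation_block_indicator:
  fixes Q :: "('n::finite) set pmf" and a c :: real
  shows "measure_pmf.expectation Q (\<lambda>T. if i \<in> T then a else c)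
       = sampling_prob Q $ i * a + (1 - sampling_prob Q $ i) * c"
proof -
  have "(\<lambda>T. if i \<in> T then a else c) = (\<lambda>T. c + (a - c) * indicator {T. i \<in> T} T)"
    by (auto simp: fun_eq_iff)
  then have "measure_pmf.expectation Q (\<lambda>T. if i \<in> T then a else c) = c + (a - c) * sampling_prob Q $ i"
    by (simp add: sampling_prob_def integrable_measure_pmf_finite)
  then show ?thesis by (simp add: algebra_simps)
qed

text \<open>The estimate that drives the method. The gain \<open>- \<langle>g\<^sup>i, h\<^sup>i\<rangle>\<close> on block \<open>i\<close> (called \<open>- r i\<close>
  below, a squared dual norm of \<open>\<nabla>\<^sub>i f(y)\<close> divided by \<open>v\<^sub>i\<close>) enters the bound for \<open>f\<close> with weight
  \<open>- p\<^sub>i / 2\<close> and the distance term with weight \<open>p\<^sub>i / 2\<close>; the weights \<open>v / p\<^sup>2\<close> are the ones for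
  which these two contributions cancel.\<close>

lemma pcd_step_descent:
  fixes b :: "'d::finite \<Rightarrow> 'n::finite" and Q :: "'n set pmf" and v :: "real^'n"
  assumes B: "\<And>i. block_pos_def b i (B i)"
    and f_convex: "convex_on UNIV f" and f_diff: "\<And>y. f differentiable (at y)"
    and proper: "proper_sampling Q" and v: "\<And>i. 0 < v $ i" and eso: "ESO b B f Q v"
    and p: "p = sampling_prob Q" and \<theta>: "\<theta> = min_entry p" and \<theta>1: "\<theta> \<le> 1"
    and w: "w = (\<chi> i. v $ i / (p $ i)\<^sup>2)"
  shows "measure_pmf.expectation Q (\<lambda>T. f (fst (pcd_step b B f p v T (x, z)))
           + \<theta>\<^sup>2 / 2 * wnorm_sq b B w (snd (pcd_step b B f p v T (x, z)) - u))
       \<le> (1 - \<theta>) * f x + \<theta> * f u + \<theta>\<^sup>2 / 2 * wnorm_sq b B w (z - u)"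
proof -
  have p_pos: "0 < p $ i" for i
    using proper by (simp add: proper_sampling_def p)
  have \<theta>_pos: "0 < \<theta>"
    using min_entry_pos[of p] p_pos by (simp add: \<theta>)
  define y where "y = (1 - \<theta>) *\<^sub>R x + \<theta> *\<^sub>R z"
  define g where "g = gradient f y"
  define h where "h = pcd_direction b B v g"
  define r where "r i = block_part b i g \<bullet> block_part b i h" for i
  define d where "d i = block_part b i (z - u)" for i
  define q where "q i a = (B i *v a) \<bullet> a" for i a
  have step: "pcd_step b B f p v T (x, z)
      = (y + restrict_blocks b T h, z + (1 / \<theta>) *\<^sub>R block_scale b p (restrict_blocks b T h))" for T
    using pcd_step_eq[OF B p_pos y_def[unfolded \<theta>] h_def[unfolded g_def]] by (simp add: \<theta>)
  have Bh: "B i *v block_part b i h = (- 1 / v $ i) *\<^sub>R block_part b i g" for i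
    unfolding h_def by (rule metric_pcd_direction[OF B])
  have qh: "q i (block_part b i h) = - r i / v $ i" for i
    by (simp add: q_def Bh r_def)
  have sym: "(B i *v a) \<bullet> c = a \<bullet> (B i *v c)" for i a c
  proof -
    have "transpose (B i) = B i" using B[of i] by (simp add: block_pos_def_def)
    then show ?thesis by (metis dot_lmul_matrix vector_transpose_matrix)
  qed
  \<comment> \<open>ESO at \<open>h\<close>: the linear term is twice the quadratic one, with the opposite sign.\<close>
  have f_step: "measure_pmf.expectation Q (\<lambda>T. f (y + restrict_blocks b T h))
      \<le> f y + 1/2 * (\<Sum>i\<in>UNIV. p $ i * r i)"
  proof -
    have "measure_pmf.expectation Q (\<lambda>T. f (y + restrict_blocks b T h))
      \<le> f y + winner b p g h + 1/2 * wnorm_sq b B (v * p) h"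
      using eso by (simp add: ESO_def p g_def)
    moreover have "winner b p g h = (\<Sum>i\<in>UNIV. p $ i * r i)"
      by (simp add: winner_def r_def)
    moreover have "wnorm_sq b B (v * p) h = (\<Sum>i\<in>UNIV. - (p $ i * r i))"
      unfolding wnorm_sq_def q_def[symmetric] qh
    proof (intro sum.cong refl)
      fix i
      show "(v * p) $ i * (- r i / v $ i) = - (p $ i * r i)"
        using v[of i] by simp
    qed
    ultimately show ?thesis by (simp add: sum_negf)
  qed
  \<comment> \<open>No inequality is lost here: the squared norm is quadratic in the step, and each block is
    drawn with probability \<open>p\<^sub>i\<close>.\<close>
  have z_step: "measure_pmf.expectation Q (\<lambda>T. \<theta>\<^sup>2 / 2 *
        wnorm_sq b B w (z + (1 / \<theta>) *\<^sub>R block_scale b p (restrict_blocks b T h) - u))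
      = \<theta>\<^sup>2 / 2 * wnorm_sq b B w (z - u) - \<theta> * (g \<bullet> (z - u)) - 1/2 * (\<Sum>i\<in>UNIV. p $ i * r i)"
  proof -
    define s where "s i = q i (d i + (p $ i / \<theta>) *\<^sub>R block_part b i h)" for i
    have s: "s i = q i (d i) - 2 * (p $ i / \<theta>) / v $ i * (block_part b i g \<bullet> d i)
        - (p $ i / \<theta>)\<^sup>2 * r i / v $ i" for i
    proof -
      have "s i = q i (d i) + 2 * (p $ i / \<theta>) * ((B i *v block_part b i h) \<bullet> d i)
          + (p $ i / \<theta>)\<^sup>2 * q i (block_part b i h)"
        unfolding s_def q_def using sym[of i "d i" "block_part b i h"]
        by (simp add: matrix_vector_right_distrib matrix_vector_mult_scaleR inner_add_left
            inner_add_right inner_commute power2_eq_square algebra_simps)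
      then show ?thesis unfolding Bh qh by simp
    qed
    have "wnorm_sq b B w (z + (1 / \<theta>) *\<^sub>R block_scale b p (restrict_blocks b T h) - u)
        = (\<Sum>i\<in>UNIV. w $ i * (if i \<in> T then s i else q i (d i)))" for T
      unfolding wnorm_sq_def q_def[symmetric] s_def d_def
      by (intro sum.cong) (auto simp: block_part_simps block_part_block_scale
          block_part_restrict_blocks add_diff_eq algebra_simps)
    then have "measure_pmf.expectation Q (\<lambda>T. \<theta>\<^sup>2 / 2 *
          wnorm_sq b B w (z + (1 / \<theta>) *\<^sub>R block_scale b p (restrict_blocks b T h) - u))
        = \<theta>\<^sup>2 / 2 * (\<Sum>i\<in>UNIV. w $ i * (p $ i * s i + (1 - p $ i) * q i (d i)))"
      by (simp add: Bochner_Integration.integral_sum integrable_measure_pmf_finite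
          expectation_block_indicator p)
    also have "\<dots> = (\<Sum>i\<in>UNIV. \<theta>\<^sup>2 / 2 * (w $ i * q i (d i))
        - \<theta> * (block_part b i g \<bullet> d i) - 1/2 * (p $ i * r i))"
      unfolding sum_distrib_left
    proof (intro sum.cong refl)
      fix i
      show "\<theta>\<^sup>2 / 2 * (w $ i * (p $ i * s i + (1 - p $ i) * q i (d i)))
        = \<theta>\<^sup>2 / 2 * (w $ i * q i (d i)) - \<theta> * (block_part b i g \<bullet> d i) - 1/2 * (p $ i * r i)"
        unfolding s w using v[of i] p_pos[of i] \<theta>_pos
        by (simp add: field_simps power2_eq_square)
    qed
    also have "\<dots> = \<theta>\<^sup>2 / 2 * wnorm_sq b B w (z - u) - \<theta> * (g \<bullet> (z - u))
        - 1/2 * (\<Sum>i\<in>UNIV. p $ i * r i)"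
      unfolding inner_eq_winner[where b = b and x = g] wnorm_sq_def winner_def q_def d_def
      by (simp add: sum_subtractf sum_distrib_left)
    finally show ?thesis .
  qed
  have "measure_pmf.expectation Q (\<lambda>T. f (fst (pcd_step b B f p v T (x, z)))
           + \<theta>\<^sup>2 / 2 * wnorm_sq b B w (snd (pcd_step b B f p v T (x, z)) - u))
      \<le> f y - \<theta> * (g \<bullet> (z - u)) + \<theta>\<^sup>2 / 2 * wnorm_sq b B w (z - u)"
    unfolding step fst_conv snd_conv
    by (subst Bochner_Integration.integral_add[OF integrable_measure_pmf_finite integrable_measure_pmf_finite,
          OF finite finite], subst z_step) (use f_step in linarith)
  \<comment> \<open>Tangent inequalities at \<open>y\<close> towards \<open>x\<close> and \<open>u\<close>, with weights \<open>1 - \<theta>\<close> and \<open>\<theta>\<close>.\<close>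
  also have "f y - \<theta> * (g \<bullet> (z - u)) \<le> (1 - \<theta>) * f x + \<theta> * f u"
  proof -
    have "\<theta> *\<^sub>R (z - u) = (1 - \<theta>) *\<^sub>R (y - x) + \<theta> *\<^sub>R (y - u)"
      by (simp add: y_def algebra_simps)
    then have "\<theta> * (g \<bullet> (z - u)) = - (1 - \<theta>) * (g \<bullet> (x - y)) - \<theta> * (g \<bullet> (u - y))"
      by (metis (no_types, opaque_lifting) add_uminus_conv_diff inner_add_right inner_minus_right inner_scaleR_right minus_diff_eq mult_minus_left mult_minus_right)
    moreover have "(1 - \<theta>) * (f y + g \<bullet> (x - y)) \<le> (1 - \<theta>) * f x"
      using convex_on_above_gradient[OF f_convex f_diff, of y x] \<theta>1
      by (intro mult_left_mono) (auto simp: g_def)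
    moreover have "\<theta> * (f y + g \<bullet> (u - y)) \<le> \<theta> * f u"
      using convex_on_above_gradient[OF f_convex f_diff, of y u] \<theta>_pos
      by (intro mult_left_mono) (auto simp: g_def)
    ultimately show ?thesis by (simp add: algebra_simps)
  qed
  finally show ?thesis by simp
qed

section \<open>The convergence rate\<close>

lemma pcd_depends_on_past:
  assumes "\<And>l. l < k \<Longrightarrow> s l = t l"
  shows "pcd b B f p v x0 s k = pcd b B f p v x0 t k"
  using assms by (induction k) auto

text \<open>With \<open>v = 0\<close> this gives nonnegativity for nonnegative weights.\<close>

lemma wnorm_sq_mono:
  assumes B: "\<And>i. block_pos_def b i (B i)" and vw: "\<And>i. v $ i \<le> w $ i"
  shows "wnorm_sq b B v x \<le> wnorm_sq b B w x"
proof -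
  have "0 \<le> (B i *v block_part b i x) \<bullet> block_part b i x" for i
    using B[of i] by (cases "block_part b i x = 0") (auto simp: block_pos_def_def less_imp_le)
  then show ?thesis
    unfolding wnorm_sq_def by (intro sum_mono mult_right_mono vw)
qed

theorem corollary3:
  fixes b :: "'d::finite \<Rightarrow> 'n::finite"
    and B :: "'n \<Rightarrow> real^'d^'d"
    and f :: "real^'d \<Rightarrow> real"
    and \<S> :: "'n set pmf"
    and p v :: "real^'n"
    and M :: "'w measure"
    and S :: "nat \<Rightarrow> 'w \<Rightarrow> 'n set"
    and x0 xopt :: "real^'d"
    and x :: "nat \<Rightarrow> 'w \<Rightarrow> real^'d"
    and \<theta> C :: real
    and G :: "nat \<Rightarrow> real"
  assumes B: "\<And>i. block_pos_def b i (B i)"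
    and f_convex: "convex_on UNIV f"
    and f_diff: "\<And>y. f differentiable (at y)"
    and proper: "proper_sampling \<S>"
    and p: "p = sampling_prob \<S>"
    and v_pos: "\<And>i. v $ i > 0"
    and eso: "ESO b B f \<S> v"
    and opt: "\<And>y. f xopt \<le> f y"
    and M: "prob_space M"
    and S_indep: "prob_space.indep_vars M (\<lambda>_. count_space UNIV) S UNIV"
    and S_distr: "\<And>k. distr M (count_space UNIV) (S k) = measure_pmf \<S>"
    and x: "\<And>k \<omega>. x k \<omega> = fst (pcd b B f p v x0 (\<lambda>l. S l \<omega>) k)"
    and \<theta>: "\<theta> = min_entry p"
    and C: "C = (1 - \<theta>) * (f x0 - f xopt) + 1/2 * wnorm_sq b B v (x0 - xopt)"
    and G: "\<And>k. G k =
      max (prob_space.expectation M (\<lambda>\<omega>.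
             f ((1 / (1 + (real k - 1) * \<theta>)) *\<^sub>R (x k \<omega> + \<theta> *\<^sub>R (\<Sum>l = 1..k - 1. x l \<omega>)))))
          (Min ((\<lambda>l. prob_space.expectation M (\<lambda>\<omega>. f (x l \<omega>))) ` {1..k}))
      - f xopt"
  shows "(\<forall>k\<ge>1. G k \<le> C / ((real k - 1) * \<theta> + 1)) \<and>
         (\<forall>\<epsilon>>0. \<forall>k\<ge>1. real k \<ge> C / (\<epsilon> * \<theta>) - 1 / \<theta> + 1 \<longrightarrow> G k \<le> \<epsilon>)"
proof -
  interpret prob_space M by (rule M)
  have p_pos: "0 < p $ i" for i
    using proper by (simp add: proper_sampling_def p)
  have \<theta>_pos: "0 < \<theta>"
    using min_entry_pos[of p] p_pos by (simp add: \<theta>)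
  have \<theta>_le: "\<theta> \<le> p $ i" for i
    by (simp add: \<theta> min_entry_le)
  have \<theta>1: "\<theta> \<le> 1"
    by (rule order_trans[OF \<theta>_le]) (simp add: p sampling_prob_def)
  define w where "w = (\<chi> i. v $ i / (p $ i)\<^sup>2)"
  define Z where "Z s k = \<theta>\<^sup>2 / 2 * wnorm_sq b B w (snd (pcd b B f p v x0 s k) - xopt)" for s k
  define X where "X s k = fst (pcd b B f p v x0 s k)" for s k
  have rv: "random_variable (count_space UNIV) (S l)" for l
    using S_indep by (simp add: indep_vars_def)
  have int: "integrable M (\<lambda>\<omega>. h (pcd b B f p v x0 (\<lambda>l. S l \<omega>) k))" for h :: "_ \<Rightarrow> real" and k
    by (rule measurable_history(3)[where k = k and h = "\<lambda>s. h (pcd b B f p v x0 s k)", OF rv])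
      (metis pcd_depends_on_past)
  have int_X: "integrable M (\<lambda>\<omega>. f (x k \<omega>))" and int_Z: "integrable M (\<lambda>\<omega>. Z (\<lambda>l. S l \<omega>) k)" for k
    unfolding x Z_def by (rule int)+
  define E where "E k = expectation (\<lambda>\<omega>. f (x k \<omega>))" for k
  define R where "R k = expectation (\<lambda>\<omega>. Z (\<lambda>l. S l \<omega>) k)" for k
  \<comment> \<open>The mean of the one-step estimate, with the draw \<open>S k\<close> averaged out first.\<close>
  have rec: "(E (Suc k) - f xopt) + R (Suc k) \<le> (1 - \<theta>) * (E k - f xopt) + R k" for k
  proof -
    define V where "V q = f (fst q) + \<theta>\<^sup>2 / 2 * wnorm_sq b B w (snd q - xopt)" for q
    have "E (Suc k) + R (Suc k) = expectation (\<lambda>\<omega>.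
        V (pcd_step b B f p v (S k \<omega>) (pcd b B f p v x0 (\<lambda>l. S l \<omega>) k)))"
      unfolding E_def R_def using int_X[of "Suc k"] int_Z[of "Suc k"]
      by (subst Bochner_Integration.integral_add[symmetric]) (auto simp: V_def Z_def x)
    also have "\<dots> = expectation (\<lambda>\<omega>. measure_pmf.expectation \<S>
        (\<lambda>T. V (pcd_step b B f p v T (pcd b B f p v x0 (\<lambda>l. S l \<omega>) k))))"
      by (rule expectation_fresh_draw[OF S_indep S_distr]) (metis pcd_depends_on_past)
    also have "\<dots> \<le> expectation (\<lambda>\<omega>. (1 - \<theta>) * f (x k \<omega>) + \<theta> * f xopt + Z (\<lambda>l. S l \<omega>) k)"
    proof (rule integral_mono)
      show "integrable M (\<lambda>\<omega>. measure_pmf.expectation \<S>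
          (\<lambda>T. V (pcd_step b B f p v T (pcd b B f p v x0 (\<lambda>l. S l \<omega>) k))))"
        by (rule int)
      show "integrable M (\<lambda>\<omega>. (1 - \<theta>) * f (x k \<omega>) + \<theta> * f xopt + Z (\<lambda>l. S l \<omega>) k)"
        using int_X int_Z by auto
      fix \<omega>
      show "measure_pmf.expectation \<S> (\<lambda>T. V (pcd_step b B f p v T (pcd b B f p v x0 (\<lambda>l. S l \<omega>) k)))
          \<le> (1 - \<theta>) * f (x k \<omega>) + \<theta> * f xopt + Z (\<lambda>l. S l \<omega>) k"
        using pcd_step_descent[OF B f_convex f_diff proper v_pos eso p \<theta> \<theta>1 w_def,
            where x = "x k \<omega>" and z = "snd (pcd b B f p v x0 (\<lambda>l. S l \<omega>) k)" and u = xopt]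
        by (simp add: V_def Z_def x)
    qed
    also have "\<dots> = (1 - \<theta>) * E k + \<theta> * f xopt + R k"
      using int_X int_Z by (simp add: E_def R_def prob_space)
    finally show ?thesis by (simp add: algebra_simps)
  qed
  have R_nonneg: "0 \<le> R k" for k
  proof -
    have "wnorm_sq b B 0 u \<le> wnorm_sq b B w u" for u
      using v_pos by (intro wnorm_sq_mono[OF B]) (simp add: w_def less_imp_le)
    then show ?thesis
      unfolding R_def Z_def by (intro Bochner_Integration.integral_nonneg) (simp add: wnorm_sq_def)
  qed
  \<comment> \<open>Since \<open>\<theta> \<le> p\<^sub>i\<close>, the weights satisfy \<open>\<theta>\<^sup>2 w \<le> v\<close>.\<close>
  have R0: "R 0 \<le> 1/2 * wnorm_sq b B v (x0 - xopt)"
  proof -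
    have "wnorm_sq b B w (x0 - xopt) \<le> wnorm_sq b B ((1 / \<theta>\<^sup>2) *\<^sub>R v) (x0 - xopt)"
    proof (rule wnorm_sq_mono[OF B])
      fix i
      have "v $ i / (p $ i)\<^sup>2 \<le> v $ i / \<theta>\<^sup>2"
        using v_pos[of i] \<theta>_pos \<theta>_le[of i] p_pos[of i]
        by (intro divide_left_mono power_mono) (auto intro: less_imp_le)
      then show "w $ i \<le> ((1 / \<theta>\<^sup>2) *\<^sub>R v) $ i" by (simp add: w_def)
    qed
    also have "\<dots> = wnorm_sq b B v (x0 - xopt) / \<theta>\<^sup>2"
      by (simp add: wnorm_sq_def sum_divide_distrib)
    finally have "\<theta>\<^sup>2 * wnorm_sq b B w (x0 - xopt) \<le> wnorm_sq b B v (x0 - xopt)"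
      using \<theta>_pos by (simp add: field_simps)
    then show ?thesis by (simp add: R_def Z_def prob_space)
  qed
  have bound: "G k \<le> C / ((real k - 1) * \<theta> + 1)" if k: "k \<ge> 1" for k
  proof -
    define W where "W = 1 + (real k - 1) * \<theta>"
    have W: "W > 0" using k \<theta>_pos by (simp add: W_def add_pos_nonneg)
    define A where "A = (E k + \<theta> * (\<Sum>l = 1..k - 1. E l)) / W"
    have "(E k - f xopt) + \<theta> * (\<Sum>l = 1..k - 1. E l - f xopt) + R k
        \<le> (1 - \<theta>) * (E 0 - f xopt) + R 0"
      by (rule weighted_average_telescope[where F = "\<lambda>k. E k - f xopt", OF rec k])
    moreover have "\<theta> * (\<Sum>l = 1..k - 1. E l - f xopt)
        = \<theta> * (\<Sum>l = 1..k - 1. E l) - (W - 1) * f xopt"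
      using k by (simp add: sum_subtractf W_def of_nat_diff algebra_simps)
    moreover have "E 0 = f x0" by (simp add: E_def x prob_space)
    ultimately have "E k + \<theta> * (\<Sum>l = 1..k - 1. E l) - W * f xopt \<le> C"
      using R0 R_nonneg[of k] unfolding C by (simp add: algebra_simps)
    then have "(E k + \<theta> * (\<Sum>l = 1..k - 1. E l) - W * f xopt) / W \<le> C / W"
      using W by (intro divide_right_mono) auto
    then have A: "A - f xopt \<le> C / W"
      using W by (simp add: A_def diff_divide_distrib)
    have "expectation (\<lambda>\<omega>. f ((1 / W) *\<^sub>R (x k \<omega> + \<theta> *\<^sub>R (\<Sum>l = 1..k - 1. x l \<omega>)))) \<le> A"
    proof -
      have "expectation (\<lambda>\<omega>. f ((1 / W) *\<^sub>R (x k \<omega> + \<theta> *\<^sub>R (\<Sum>l = 1..k - 1. x l \<omega>))))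
          \<le> expectation (\<lambda>\<omega>. (f (x k \<omega>) + \<theta> * (\<Sum>l = 1..k - 1. f (x l \<omega>))) / W)"
      proof (rule integral_mono)
        define J where "J s = f ((1 / W) *\<^sub>R (X s k + \<theta> *\<^sub>R (\<Sum>l = 1..k - 1. X s l)))" for s
        have J: "J s = J t" if st: "\<And>l. l < k \<Longrightarrow> s l = t l" for s t
        proof -
          have X: "X s l = X t l" if "l \<le> k" for l
            using st that by (simp add: X_def pcd_depends_on_past[of l s t])
          have "(\<Sum>l = 1..k - 1. X s l) = (\<Sum>l = 1..k - 1. X t l)"
            by (intro sum.cong refl X) auto
          then show ?thesis by (simp add: J_def X)
        qed
        have "integrable M (\<lambda>\<omega>. J (\<lambda>l. S l \<omega>))"
          using rv J by (rule measurable_history(3))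
        then show "integrable M (\<lambda>\<omega>. f ((1 / W) *\<^sub>R (x k \<omega> + \<theta> *\<^sub>R (\<Sum>l = 1..k - 1. x l \<omega>))))"
          by (simp only: J_def X_def x)
        show "integrable M (\<lambda>\<omega>. (f (x k \<omega>) + \<theta> * (\<Sum>l = 1..k - 1. f (x l \<omega>))) / W)"
          using int_X by auto
        show "f ((1 / W) *\<^sub>R (x k \<omega> + \<theta> *\<^sub>R (\<Sum>l = 1..k - 1. x l \<omega>)))
            \<le> (f (x k \<omega>) + \<theta> * (\<Sum>l = 1..k - 1. f (x l \<omega>))) / W" for \<omega>
          unfolding W_def using \<theta>_pos
          by (intro convex_on_weighted_average[OF f_convex _ k, where y = "\<lambda>l. x l \<omega>"]) simp
      qed
      also have "\<dots> = A"
        using int_X by (simp add: A_def E_def)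
      finally show ?thesis .
    qed
    moreover have "Min (E ` {1..k}) \<le> A"
      unfolding A_def W_def using \<theta>_pos k by (intro Min_le_weighted_average) auto
    ultimately have "G k \<le> A - f xopt"
      unfolding G W_def E_def by simp
    with A show ?thesis by (simp add: W_def add.commute)
  qed
  moreover have "G k \<le> \<epsilon>"
    if "\<epsilon> > 0" "k \<ge> 1" "real k \<ge> C / (\<epsilon> * \<theta>) - 1 / \<theta> + 1" for \<epsilon> k
  proof -
    have "C / (\<epsilon> * \<theta>) * (\<epsilon> * \<theta>) \<le> (real k - 1 + 1 / \<theta>) * (\<epsilon> * \<theta>)"
      using that \<theta>_pos by (intro mult_right_mono) auto
    moreover have "C / (\<epsilon> * \<theta>) * (\<epsilon> * \<theta>) = C"
      using that(1) \<theta>_pos by simp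
    moreover have "(real k - 1 + 1 / \<theta>) * (\<epsilon> * \<theta>) = \<epsilon> * ((real k - 1) * \<theta> + 1)"
      using \<theta>_pos by (simp add: distrib_left distrib_right)
    ultimately have "C \<le> \<epsilon> * ((real k - 1) * \<theta> + 1)"
      by simp
    moreover have "(real k - 1) * \<theta> + 1 > 0"
      using that \<theta>_pos by (simp add: add_nonneg_pos)
    ultimately have "C / ((real k - 1) * \<theta> + 1) \<le> \<epsilon>"
      by (simp only: pos_divide_le_eq)
    with bound[OF that(2)] show ?thesis
      by (rule order_trans)
  qed
  ultimately show ?thesis by blast
qed

end
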